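(* Let $n\ge 2$ be an integer, let $A$ be a unital algebra over a commutative unital ring $\mathcal{R}$, and let $\mathcal{A}=T_2(A)$ be the algebra of upper triangular $2\times 2$ matrices over $A$. Suppose that $\mathcal{A}$ is $2$- and $(n-1)$-torsion free, and that $A$ is a commutative algebra or a noncommutative prime algebra. Then every Lie $n$-derivation on $T_2(A)$ is standard.
   Context: Linear means $\mathcal{R}$-linear; $\mathcal{Z}(\mathcal{A})$ is the centre of $\mathcal{A}$. An algebra $A$ is prime if $aAb=\{0\}$ implies $a=0$ or $b=0$. For a positive integer $k$, $\mathcal{A}$ is $k$-torsion free if $kx=0$ implies $x=0$ for each $x\in\mathcal{A}$. $[x,y]=xy-yx$. Define $p_1(x_1)=x_1$ and $p_n(x_1,\dots,x_n)=[p_{n-1}(x_1,\dots,x_{n-1}),x_n]$ for $n\ge2$; for $n\ge 2$, $p_n(x_1,\dots,x_n)$ is called an $(n-1)$-th commutator. A linear map $\varphi:\mathcal{A}\to\mathcal{A}$ is a Lie $n$-derivation if $\varphi(p_n(x_1,\dots,x_n))=\sum_{i=1}^n p_n(x_1,\dots,x_{i-1},\varphi(x_i),x_{i+1},\dots,x_n)$ for all $x_1,\dots,x_n\in\mathcal{A}$. A Lie $n$-derivation is standard if it equals $h+\tau$ with $h$ a derivation on $\mathcal{A}$ (linear, $h(xy)=h(x)y+xh(y)$) and $\tau$ a linear mapping from $\mathcal{A}$ into $\mathcal{Z}(\mathcal{A})$ vanishing on all $(n-1)$-th commutators of $\mathcal{A}$. *)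

theory Defs
  imports "HOL-Analysis.Cartesian_Space"
begin

section \<open>Unital associative algebras over a commutative ring\<close>

text \<open>The algebra need not be commutative. Scalars and elements live in the type classes
  \<^class>\<open>comm_ring_1\<close> and \<^class>\<open>ring_1\<close>, so both are unital with \<open>0 \<noteq> 1\<close>.\<close>

locale unital_algebra = module smult
  for smult :: "'r::comm_ring_1 \<Rightarrow> 'a::ring_1 \<Rightarrow> 'a" +
  assumes smult_mult_left: "smult r x * y = smult r (x * y)"
    and smult_mult_right: "x * smult r y = smult r (x * y)"

definition centre :: "'a::ring set" where
  "centre = {z. \<forall>x. z * x = x * z}"

definition prime_ring :: "'a::ring itself \<Rightarrow> bool" where
  "prime_ring _ \<longleftrightarrow> (\<forall>a b :: 'a. (\<forall>x. a * x * b = 0) \<longrightarrow> a = 0 \<or> b = 0)"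

definition commutative_ring :: "'a::ring itself \<Rightarrow> bool" where
  "commutative_ring _ \<longleftrightarrow> (\<forall>a b :: 'a. a * b = b * a)"

definition torsion_free :: "nat \<Rightarrow> 'a::ring_1 itself \<Rightarrow> bool" where
  "torsion_free k _ \<longleftrightarrow> (\<forall>x :: 'a. of_nat k * x = 0 \<longrightarrow> x = 0)"


section \<open>Iterated commutators and Lie \<open>n\<close>-derivations\<close>

definition commutator :: "'a::ring \<Rightarrow> 'a \<Rightarrow> 'a" where
  "commutator x y = x * y - y * x"

text \<open>The arguments \<open>x\<^sub>1, \<dots>, x\<^sub>n\<close> of the polynomial \<open>p\<^sub>n\<close> are given as a sequence \<open>x\<close>, of which only
  the entries \<open>x 1, \<dots>, x n\<close> matter. The value for \<open>n = 0\<close> is a dummy.\<close>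

fun lie_poly :: "nat \<Rightarrow> (nat \<Rightarrow> 'a::ring) \<Rightarrow> 'a" where
  "lie_poly 0 x = 0"
| "lie_poly (Suc 0) x = x 1"
| "lie_poly (Suc (Suc n)) x = commutator (lie_poly (Suc n) x) (x (Suc (Suc n)))"

definition lie_n_derivation ::
    "('r::comm_ring_1 \<Rightarrow> 'a::ring \<Rightarrow> 'a) \<Rightarrow> nat \<Rightarrow> ('a \<Rightarrow> 'a) \<Rightarrow> bool" where
  "lie_n_derivation smult n \<phi> \<longleftrightarrow> module_hom smult smult \<phi> \<and>
     (\<forall>x. \<phi> (lie_poly n x) = (\<Sum>i=1..n. lie_poly n (x(i := \<phi> (x i)))))"

definition derivation :: "('r::comm_ring_1 \<Rightarrow> 'a::ring \<Rightarrow> 'a) \<Rightarrow> ('a \<Rightarrow> 'a) \<Rightarrow> bool" where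
  "derivation smult h \<longleftrightarrow> module_hom smult smult h \<and> (\<forall>x y. h (x * y) = h x * y + x * h y)"

definition standard_lie_n_derivation ::
    "('r::comm_ring_1 \<Rightarrow> 'a::ring \<Rightarrow> 'a) \<Rightarrow> nat \<Rightarrow> ('a \<Rightarrow> 'a) \<Rightarrow> bool" where
  "standard_lie_n_derivation smult n \<phi> \<longleftrightarrow> lie_n_derivation smult n \<phi> \<and>
     (\<exists>h \<tau>. derivation smult h \<and> module_hom smult smult \<tau> \<and> range \<tau> \<subseteq> centre \<and>
        (\<forall>x. \<tau> (lie_poly n x) = 0) \<and> (\<forall>x. \<phi> x = h x + \<tau> x))"


section \<open>The algebra of upper triangular \<open>2 \<times> 2\<close> matrices\<close>

typedef (overloaded) 'a upper_tri2 = "{M :: 'a::zero ^ 2 ^ 2. M $ 2 $ 1 = 0}"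
  by (rule exI[of _ 0]) simp

setup_lifting type_definition_upper_tri2

instantiation upper_tri2 :: (ring_1) ring_1
begin

lift_definition zero_upper_tri2 :: "'a upper_tri2" is 0 by simp

lift_definition one_upper_tri2 :: "'a upper_tri2" is "mat 1"
  by (simp add: mat_def)

lift_definition plus_upper_tri2 :: "'a upper_tri2 \<Rightarrow> 'a upper_tri2 \<Rightarrow> 'a upper_tri2"
  is "(+)" by simp

lift_definition minus_upper_tri2 :: "'a upper_tri2 \<Rightarrow> 'a upper_tri2 \<Rightarrow> 'a upper_tri2"
  is "(-)" by simp

lift_definition uminus_upper_tri2 :: "'a upper_tri2 \<Rightarrow> 'a upper_tri2" is uminus by simp

lift_definition times_upper_tri2 :: "'a upper_tri2 \<Rightarrow> 'a upper_tri2 \<Rightarrow> 'a upper_tri2"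
  is "(**)" by (simp add: matrix_matrix_mult_def sum_2)

instance
proof
  fix a b c :: "'a upper_tri2"
  show "a * b * c = a * (b * c)" by transfer (simp add: matrix_mul_assoc)
  show "1 * a = a" by transfer simp
  show "a * 1 = a" by transfer simp
  show "(a + b) * c = a * c + b * c"
    by transfer (simp add: matrix_matrix_mult_def vec_eq_iff sum_2 algebra_simps)
  show "a * (b + c) = a * b + a * c" by transfer (rule matrix_add_ldistrib)
  show "(0 :: 'a upper_tri2) \<noteq> 1"
    by transfer (simp add: mat_def vec_eq_iff forall_2)
qed (transfer, simp)+

end

text \<open>Entrywise scalar multiplication. The abstraction function is applied to an upper triangular
  matrix whenever \<open>smult r 0 = 0\<close>, in particular when \<open>smult\<close> is a module structure.\<close>

definition smult_upper_tri2 ::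
    "('r \<Rightarrow> 'a \<Rightarrow> 'a) \<Rightarrow> 'r \<Rightarrow> 'a::zero upper_tri2 \<Rightarrow> 'a upper_tri2" where
  "smult_upper_tri2 smult r M = Abs_upper_tri2 (\<chi> i j. smult r (Rep_upper_tri2 M $ i $ j))"

context unital_algebra
begin

lemma Rep_smult_upper_tri2:
  "Rep_upper_tri2 (smult_upper_tri2 smult r M) = (\<chi> i j. smult r (Rep_upper_tri2 M $ i $ j))"
  unfolding smult_upper_tri2_def
  using Rep_upper_tri2 [of M] by (simp add: Abs_upper_tri2_inverse)

lemma unital_algebra_upper_tri2: "unital_algebra (smult_upper_tri2 smult)"
  by unfold_locales
    (simp_all add: Rep_upper_tri2_inject [symmetric] Rep_smult_upper_tri2 plus_upper_tri2.rep_eq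
      times_upper_tri2.rep_eq matrix_matrix_mult_def vec_eq_iff sum_2
      scale_right_distrib scale_left_distrib smult_mult_left smult_mult_right)

end

end

theory Submission
  imports Defs
begin

text \<open>Write \<open>(a, m, b)\<close> for the matrix with diagonal \<open>a, b\<close> and corner \<open>m\<close>, and put
  \<open>f = (0, 0, 1)\<close>. Commutation with \<open>f\<close> on the right projects a matrix onto its corner:
  \<open>[(a, m, b), f] = (0, m, 0)\<close>. Hence filling the last arguments of \<open>p\<^sub>n\<close> with \<open>f\<close> turns the law
  of a Lie \<open>n\<close>-derivation \<open>\<phi>\<close> into an ordinary Leibniz rule for commutators that lie in the
  corner, and most of the case \<open>n = 2\<close> carries over.

  For this to work, \<open>\<phi> f\<close> must contribute nothing. Evaluating \<open>\<phi>\<close> at \<open>p\<^sub>n((0, m, 0), f, \<dots>, f)\<close>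
  shows that \<open>n - 1\<close> times the corner of \<open>[(0, m, 0), \<phi> f]\<close> is \<open>0\<close>, so by torsion freeness the
  diagonal of \<open>\<phi> f\<close> is a central scalar (\<open>lie_n_derivation_at_idempotent\<close>). The corner of
  \<open>\<phi> f\<close> is removed by adding an inner derivation. Then \<open>\<phi>\<close> acts on the corner by an
  additive map \<open>g\<close>, and \<open>\<phi>(a, m, b) = (P(a) + P'(b), g m, Q(a) + Q'(b))\<close>, where
  \[ g(am) = P(a) m - m Q(a) + a g(m), \qquad g(mb) = m Q'(b) - P'(b) m + g(m) b. \]
  As soon as \<open>Q(a)\<close> and \<open>P'(b)\<close> are central, these formulas say that
  \<open>h(a, m, b) = (P(a) - Q(a), g m, Q'(b) - P'(b))\<close> is a derivation
  (\<open>derivation_from_corner_laws\<close>), and \<open>\<phi> - h\<close> is the central scalar \<open>Q(a) + P'(b)\<close>. It vanishes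
  on \<open>p\<^sub>n\<close> because it is itself a Lie \<open>n\<close>-derivation, and \<open>p\<^sub>n\<close> is \<open>0\<close> whenever one of its arguments
  is central (\<open>standard_if_central_difference\<close>).

  Centrality is clear over a commutative \<open>A\<close>. In general, applying \<open>\<phi>\<close> to \<open>p\<^sub>n\<close> with
  the commuting first arguments \<open>(a, 0, 0)\<close> and \<open>(0, 0, b)\<close> shows that \<open>[a, P'(b)]\<close> and
  \<open>[Q(a), b]\<close> are central, and in a prime ring an element whose commutators are all
  central is central itself (\<open>prime_central_commutators\<close>).\<close>

section \<open>Iterated commutators\<close>

lemma commutator_simps [simp]:
  "commutator 0 y = 0" "commutator x 0 = 0"
  "commutator (u + v) y = commutator u y + commutator v y"
  "commutator x (u + v) = commutator x u + commutator x v"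
  by (simp_all add: commutator_def algebra_simps)

lemma commutator_centre: "z \<in> centre \<Longrightarrow> commutator z x = 0" "z \<in> centre \<Longrightarrow> commutator x z = 0"
  by (auto simp: centre_def commutator_def)

lemma lie_poly_Suc: "1 \<le> k \<Longrightarrow> lie_poly (Suc k) x = commutator (lie_poly k x) (x (Suc k))"
  by (cases k) auto

lemma lie_poly_2: "lie_poly 2 x = commutator (x 1) (x 2)"
  by (simp add: numeral_2_eq_2)

lemma lie_poly_3: "lie_poly 3 x = commutator (commutator (x 1) (x 2)) (x 3)"
  by (simp add: numeral_2_eq_2 numeral_3_eq_3)

lemma lie_poly_cong: "(\<And>i. 1 \<le> i \<Longrightarrow> i \<le> k \<Longrightarrow> x i = y i) \<Longrightarrow> lie_poly k x = lie_poly k y"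
  by (induction k x rule: lie_poly.induct) auto

lemma lie_poly_upd_beyond: "k < i \<Longrightarrow> lie_poly k (x(i := u)) = lie_poly k x"
  by (rule lie_poly_cong) auto

lemma lie_poly_upd_last:
  "1 \<le> k \<Longrightarrow> lie_poly (Suc k) (x(Suc k := u)) = commutator (lie_poly k x) u"
  using lie_poly_Suc[of k "x(Suc k := u)"] lie_poly_upd_beyond[of k "Suc k" x u] by simp

lemma lie_poly_upd_earlier:
  "\<lbrakk>1 \<le> k; i \<noteq> Suc k\<rbrakk> \<Longrightarrow>
    lie_poly (Suc k) (x(i := u)) = commutator (lie_poly k (x(i := u))) (x (Suc k))"
  using lie_poly_Suc[of k "x(i := u)"] by simp

lemma lie_poly_upd_add:
  "\<lbrakk>1 \<le> i; i \<le> n\<rbrakk> \<Longrightarrow> lie_poly n (x(i := u + v)) = lie_poly n (x(i := u)) + lie_poly n (x(i := v))"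
proof (induction n)
  case (Suc k)
  consider "k = 0" "i = 1" | "1 \<le> k" "i = Suc k" | "1 \<le> k" "i \<le> k"
    using Suc.prems by linarith
  then show ?case
    using Suc by cases (simp_all add: lie_poly_upd_last lie_poly_upd_earlier del: fun_upd_apply,
        simp)
qed simp

lemma lie_poly_zero_prefix:
  assumes "lie_poly k x = 0" "1 \<le> k" "k \<le> n"
  shows "lie_poly n x = 0"
  using assms(3)
proof (induction n rule: dec_induct)
  case (step j)
  then show ?case
    using lie_poly_Suc[of j x] assms(2) by simp
qed (rule assms(1))

lemma lie_poly_central_argument:
  assumes "2 \<le> n" "1 \<le> i" "i \<le> n" "x i \<in> centre"
  shows "lie_poly n x = 0"
proof (cases "i = 1")
  case True
  then show ?thesis
    using assms by - (rule lie_poly_zero_prefix[of 2], auto simp: lie_poly_2 commutator_centre)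
next
  case False
  then have "lie_poly i x = 0"
    using assms lie_poly_Suc[of "i - 1" x] by (simp add: commutator_centre)
  then show ?thesis
    using assms(2,3) by (rule lie_poly_zero_prefix)
qed

section \<open>Derivations and Lie \<open>n\<close>-derivations\<close>

lemma derivation_lie_poly:
  assumes "derivation s h" "1 \<le> n"
  shows "h (lie_poly n x) = (\<Sum>i=1..n. lie_poly n (x(i := h (x i))))"
  using assms(2)
proof (induction n rule: dec_induct)
  case (step k)
  have hom: "module_hom s s h" and leibniz: "h (u * v) = h u * v + u * h v" for u v
    using assms(1) by (auto simp: derivation_def)
  have "h (commutator u v) = commutator (h u) v + commutator u (h v)" for u v
    by (simp add: commutator_def leibniz module_hom.diff[OF hom])
  moreover have "(\<Sum>i=1..k. lie_poly (Suc k) (x(i := h (x i)))) =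
      commutator (\<Sum>i=1..k. lie_poly k (x(i := h (x i)))) (x (Suc k))"
    using step.hyps by (simp add: lie_poly_upd_earlier commutator_def sum_distrib_left
        sum_distrib_right sum_subtractf)
  ultimately show ?case
    using step lie_poly_Suc[of k x] by (simp add: lie_poly_upd_last del: fun_upd_apply)
qed simp

lemma module_hom_add':
  assumes "module_hom s s \<phi>" "module_hom s s \<psi>"
  shows "module_hom s s (\<lambda>x. \<phi> x + \<psi> x)"
  using assms by (simp add: module_hom_iff module.scale_right_distrib)

lemma module_hom_diff':
  assumes "module_hom s s \<phi>" "module_hom s s \<psi>"
  shows "module_hom s s (\<lambda>x. \<phi> x - \<psi> x)"
  using assms by (simp add: module_hom_iff module.scale_right_diff_distrib)

lemma lie_n_derivation_add_derivation:
  assumes "lie_n_derivation s n \<phi>" "derivation s h" "1 \<le> n"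
  shows "lie_n_derivation s n (\<lambda>x. \<phi> x + h x)"
  using assms derivation_lie_poly[OF assms(2,3)]
  by (simp add: lie_n_derivation_def lie_poly_upd_add sum.distrib derivation_def module_hom_add')

lemma derivation_diff:
  assumes "derivation s h" "derivation s d"
  shows "derivation s (\<lambda>x. h x - d x)"
  using assms by (simp add: derivation_def module_hom_diff') (simp add: algebra_simps)

lemma derivation_inner:
  assumes "unital_algebra s"
  shows "derivation s (\<lambda>x. commutator x c)"
proof -
  interpret unital_algebra s by fact
  show ?thesis
    by (auto simp: derivation_def module_hom_iff module_axioms commutator_def algebra_simps
        smult_mult_left smult_mult_right scale_right_diff_distrib)
qed

text \<open>The difference \<open>\<tau> = \<phi> - h\<close> satisfies the law of a Lie \<open>n\<close>-derivation, whose right-hand side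
  consists of values of \<open>p\<^sub>n\<close> with a central argument. So the vanishing of \<open>\<tau>\<close> on
  \<open>(n - 1)\<close>-th commutators comes for free once its values are central.\<close>

lemma standard_if_central_difference:
  assumes "2 \<le> n" "lie_n_derivation s n \<phi>" "derivation s h" and central: "\<And>x. \<phi> x - h x \<in> centre"
  shows "standard_lie_n_derivation s n \<phi>"
proof -
  have "\<phi> (lie_poly n x) - h (lie_poly n x) = 0" for x
  proof -
    have "lie_poly n (x(i := \<phi> (x i))) = lie_poly n (x(i := h (x i)))" if "i \<in> {1..n}" for i
    proof -
      have "lie_poly n (x(i := \<phi> (x i) - h (x i))) = 0"
        using that assms(1) central by - (rule lie_poly_central_argument[of n i], auto)
      then show ?thesis
        using that lie_poly_upd_add[of i n x "\<phi> (x i) - h (x i)" "h (x i)"] by simp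
    qed
    then show ?thesis
      using assms(1-3) by (simp add: lie_n_derivation_def derivation_lie_poly)
  qed
  moreover have "module_hom s s (\<lambda>x. \<phi> x - h x)"
    using assms(2,3) by (simp add: lie_n_derivation_def derivation_def module_hom_diff')
  ultimately show ?thesis
    unfolding standard_lie_n_derivation_def using assms(2,3) central
    by - (rule conjI[OF assms(2)], rule exI[of _ h], rule exI[of _ "\<lambda>x. \<phi> x - h x"],
        simp add: image_subset_iff)
qed

text \<open>Since \<open>[q, bq] = [q, b] q\<close>, the element \<open>[q, b] q\<close> is central together with \<open>[q, b]\<close>.
  Commuting it with \<open>b\<close> gives \<open>[q, b]\<^sup>2 = 0\<close>, and a prime ring has no nonzero central elements
  of square zero.\<close>

lemma prime_central_commutators:
  fixes q :: "'a::ring"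
  assumes "prime_ring TYPE('a)" and central: "\<And>b. commutator q b \<in> centre"
  shows "q \<in> centre"
proof -
  have "commutator q b = 0" for b
  proof -
    define c where "c = commutator q b"
    have c: "c * x = x * c" for x
      using central[of b] by (simp add: c_def centre_def)
    have "commutator q (b * q) = c * q"
      by (simp add: c_def commutator_def algebra_simps)
    then have "c * q * b = b * (c * q)"
      using central[of "b * q"] by (simp add: centre_def)
    also have "\<dots> = c * b * q"
      using c[of b] by (simp add: mult.assoc[symmetric])
    finally have "c * (q * b - b * q) = 0"
      by (simp add: right_diff_distrib mult.assoc)
    then have "c * c = 0"
      by (simp add: c_def commutator_def)
    then have "c * x * c = 0" for x
      using c[of x] by (simp add: mult.assoc)
    then show ?thesis
      using assms(1) unfolding prime_ring_def c_def by blast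
  qed
  then show ?thesis
    by (simp add: centre_def commutator_def)
qed

section \<open>Coordinates on upper triangular matrices\<close>

lift_definition tri :: "'a \<Rightarrow> 'a \<Rightarrow> 'a \<Rightarrow> 'a::ring_1 upper_tri2" is
  "\<lambda>a m b. \<chi> i j. if i = 1 then (if j = 1 then a else m) else (if j = 1 then 0 else b)"
  by simp

lift_definition diag1 :: "'a::ring_1 upper_tri2 \<Rightarrow> 'a" is "\<lambda>M. M $ 1 $ 1" .
lift_definition corner :: "'a::ring_1 upper_tri2 \<Rightarrow> 'a" is "\<lambda>M. M $ 1 $ 2" .
lift_definition diag2 :: "'a::ring_1 upper_tri2 \<Rightarrow> 'a" is "\<lambda>M. M $ 2 $ 2" .

lemma tri_entries [simp]:
  "diag1 (tri a m b) = a" "corner (tri a m b) = m" "diag2 (tri a m b) = b"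
  by (transfer; simp)+

lemma tri_collapse [simp]: "tri (diag1 x) (corner x) (diag2 x) = x"
  by transfer (simp add: vec_eq_iff forall_2)

lemma tri_eq_iff [simp]: "tri a m b = tri a' m' b' \<longleftrightarrow> a = a' \<and> m = m' \<and> b = b'"
  by (metis tri_entries)

lemma tri_cases: obtains a m b where "x = tri a m b"
  by (metis tri_collapse)

lemma tri_add [simp]: "tri a m b + tri a' m' b' = tri (a + a') (m + m') (b + b')"
  and tri_diff [simp]: "tri a m b - tri a' m' b' = tri (a - a') (m - m') (b - b')"
  and tri_mult [simp]: "tri a m b * tri a' m' b' = tri (a * a') (a * m' + m * b') (b * b')"
  by (transfer; simp add: vec_eq_iff forall_2 matrix_matrix_mult_def sum_2)+

lemma tri_0: "(0 :: 'a::ring_1 upper_tri2) = tri 0 0 0"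
  by transfer (simp add: vec_eq_iff)

lemma entries_add [simp]:
  "diag1 (x + y) = diag1 x + diag1 y" "corner (x + y) = corner x + corner y"
  "diag2 (x + y) = diag2 x + diag2 y"
  by (transfer; simp)+

lemma of_nat_mult_corner: "of_nat k * tri 0 u 0 = tri 0 (of_nat k * u) 0"
  by (induction k) (simp_all add: distrib_right, simp add: tri_0)

lemma (in unital_algebra) entries_smult [simp]:
  "diag1 (smult_upper_tri2 smult r x) = smult r (diag1 x)"
  "corner (smult_upper_tri2 smult r x) = smult r (corner x)"
  "diag2 (smult_upper_tri2 smult r x) = smult r (diag2 x)"
  by (simp_all add: diag1.rep_eq corner.rep_eq diag2.rep_eq Rep_smult_upper_tri2)

lemma (in unital_algebra) smult_tri:
  "smult_upper_tri2 smult r (tri a m b) = tri (smult r a) (smult r m) (smult r b)"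
  by (metis entries_smult tri_collapse tri_entries)

lemma commutator_tri:
  "commutator (tri a m b) (tri a' m' b') =
     tri (commutator a a') (a * m' + m * b' - (a' * m + m' * b)) (commutator b b')"
  by (simp add: commutator_def)

lemma scalar_in_centre:
  assumes "c \<in> centre"
  shows "tri c 0 c \<in> centre"
proof -
  have "tri c 0 c * x = x * tri c 0 c" for x
    using assms by (cases x rule: tri_cases) (simp add: centre_def)
  then show ?thesis
    by (simp add: centre_def)
qed

text \<open>The corner is an eigenspace of right commutation with the idempotent \<open>(0, 0, 1)\<close>, for the
  eigenvalue \<open>1\<close>, so padding the arguments of \<open>p\<^sub>n\<close> by this idempotent changes nothing.\<close>

lemma lie_poly_corner_padded:
  assumes "lie_poly k x = tri 0 u 0" "1 \<le> k" "k \<le> n" "\<And>j. k < j \<Longrightarrow> j \<le> n \<Longrightarrow> x j = tri 0 0 1"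
  shows "lie_poly n x = tri 0 u 0"
  using assms(3,4)
proof (induction n rule: dec_induct)
  case (step j)
  then show ?case
    using assms(2) by (simp add: lie_poly_Suc commutator_tri)
qed (use assms(1) in simp)

section \<open>Lie \<open>n\<close>-derivations of upper triangular matrices\<close>

text \<open>In \<open>p\<^sub>n((0, m, 0), f, \<dots>, f)\<close> each of the \<open>n - 1\<close> positions of \<open>f\<close> contributes the same
  summand \<open>(0, mb\<^sub>0 - a\<^sub>0m, 0)\<close>, where \<open>\<phi> f = (a\<^sub>0, m\<^sub>0, b\<^sub>0)\<close>, while the corner of the remaining
  summand already agrees with that of the left-hand side. This is the place where
  \<open>(n - 1)\<close>-torsion freeness enters.\<close>

lemma lie_n_derivation_at_idempotent:
  fixes \<phi> :: "'a::ring_1 upper_tri2 \<Rightarrow> 'a upper_tri2"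
  assumes "2 \<le> n" "lie_n_derivation s n \<phi>" and tf: "torsion_free (n - 1) TYPE('a upper_tri2)"
  obtains c m\<^sub>0 where "c \<in> centre" "\<phi> (tri 0 0 1) = tri c m\<^sub>0 c"
proof -
  obtain a\<^sub>0 m\<^sub>0 b\<^sub>0 where f: "\<phi> (tri 0 0 1) = tri a\<^sub>0 m\<^sub>0 b\<^sub>0"
    by (rule tri_cases)
  have eq: "m * b\<^sub>0 = a\<^sub>0 * m" for m
  proof -
    define w :: "'a upper_tri2" where "w = tri 0 (m * b\<^sub>0 - a\<^sub>0 * m) 0"
    define x where "x = (\<lambda>i::nat. tri 0 0 (1::'a))(1 := tri 0 m 0)"
    have pad: "lie_poly k x = tri 0 m 0" if "1 \<le> k" for k
      using that by - (rule lie_poly_corner_padded[of 1], auto simp: x_def)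
    have "lie_poly n (x(i := \<phi> (x i))) = w" if "i \<in> {2..n}" for i
    proof -
      define j where "j = i - 1"
      with that have j: "i = Suc j" "1 \<le> j"
        by auto
      have "lie_poly i (x(i := \<phi> (x i))) = commutator (tri 0 m 0) (\<phi> (x i))"
        using j pad[of j] by (simp add: lie_poly_upd_last del: fun_upd_apply)
      also have "\<dots> = w"
        using j by (simp add: x_def f commutator_tri w_def)
      finally have "lie_poly i (x(i := \<phi> (x i))) = w" .
      then show ?thesis
        using that unfolding w_def
        by - (rule lie_poly_corner_padded[of i], auto simp: x_def)
    qed
    then have tail: "(\<Sum>i=2..n. lie_poly n (x(i := \<phi> (x i)))) = of_nat (n - 1) * w"
      by simp
    have head: "lie_poly n (x(1 := \<phi> (x 1))) = tri 0 (corner (\<phi> (tri 0 m 0))) 0"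
    proof (rule lie_poly_corner_padded[of 2])
      show "lie_poly 2 (x(1 := \<phi> (x 1))) = tri 0 (corner (\<phi> (tri 0 m 0))) 0"
        by (rule tri_cases[of "\<phi> (tri 0 m 0)"])
          (simp add: x_def lie_poly_2 commutator_tri, simp add: commutator_def)
    qed (use assms(1) in \<open>auto simp: x_def\<close>)
    have "\<phi> (tri 0 m 0) = (\<Sum>i=1..n. lie_poly n (x(i := \<phi> (x i))))"
      using assms(1,2) pad[of n] by (metis lie_n_derivation_def one_le_numeral order_trans)
    also have "\<dots> = lie_poly n (x(1 := \<phi> (x 1))) + (\<Sum>i=2..n. lie_poly n (x(i := \<phi> (x i))))"
      using assms(1) by (subst sum.atLeast_Suc_atMost) (auto simp: numeral_2_eq_2)
    finally have *: "\<phi> (tri 0 m 0) = tri 0 (corner (\<phi> (tri 0 m 0))) 0 + of_nat (n - 1) * w"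
      using head tail by simp
    have "corner (of_nat (n - 1) * w) = 0"
      using arg_cong[OF *, of corner] by simp
    then have "of_nat (n - 1) * w = 0"
      by (simp add: w_def of_nat_mult_corner tri_0)
    then have "w = 0"
      using tf unfolding torsion_free_def by blast
    then show ?thesis
      by (simp add: w_def tri_0)
  qed
  have "b\<^sub>0 = a\<^sub>0"
    using eq[of 1] by simp
  with eq f show ?thesis
    by (intro that[of a\<^sub>0 m\<^sub>0]) (auto simp: centre_def)
qed

text \<open>The summands of the law with \<open>\<phi> f\<close> as an argument vanish, and what is left is the
  Leibniz rule for \<open>[x, y]\<close>.\<close>

lemma corner_leibniz:
  assumes "2 \<le> n" "lie_n_derivation s n \<phi>" and f: "\<phi> (tri 0 0 1) \<in> centre"
    and u: "commutator x y = tri 0 u 0"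
    and v: "commutator (\<phi> x) y = tri 0 v 0"
    and w: "commutator x (\<phi> y) = tri 0 w 0"
  shows "\<phi> (tri 0 u 0) = tri 0 (v + w) 0"
proof -
  define z where "z = (\<lambda>i::nat. tri 0 0 1)(1 := x, 2 := y)"
  have z: "lie_poly n z = tri 0 u 0"
    "lie_poly n (z(1 := \<phi> (z 1))) = tri 0 v 0" "lie_poly n (z(2 := \<phi> (z 2))) = tri 0 w 0"
    using u v w assms(1)
    by - (rule lie_poly_corner_padded[of 2]; auto simp: z_def lie_poly_2)+
  have "lie_poly n (z(i := \<phi> (z i))) = 0" if "i \<in> {3..n}" for i
    using that f by - (rule lie_poly_central_argument[of n i], auto simp: z_def)
  then have "(\<Sum>i=1..n. lie_poly n (z(i := \<phi> (z i)))) =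
      (\<Sum>i\<in>{1,2}. lie_poly n (z(i := \<phi> (z i))))"
    using assms(1) by (intro sum.mono_neutral_right) auto
  also have "\<dots> = tri 0 (v + w) 0"
    using z by simp
  finally have "(\<Sum>i=1..n. lie_poly n (z(i := \<phi> (z i)))) = tri 0 (v + w) 0" .
  moreover have "\<phi> (lie_poly n z) = (\<Sum>i=1..n. lie_poly n (z(i := \<phi> (z i))))"
    using assms(2) unfolding lie_n_derivation_def by blast
  ultimately show ?thesis
    by (simp only: z(1))
qed

text \<open>A third argument \<open>(0, m, 0)\<close> of \<open>p\<^sub>n\<close> makes the diagonal visible in the corner, where it
  survives the remaining padding: \<open>[(u, p, v), (0, m, 0)] = (0, um - mv, 0)\<close>. For \<open>n = 2\<close> there
  is no third argument, but then the commutator \<open>w\<close> itself vanishes.\<close>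

lemma commuting_diagonals:
  assumes "2 \<le> n" "lie_n_derivation s n \<phi>" "commutator x y = 0"
    and w: "w = commutator (\<phi> x) y + commutator x (\<phi> y)"
  shows "diag1 w * m = m * diag2 w"
proof -
  have "\<phi> 0 = 0"
    using assms(2) module_hom.zero unfolding lie_n_derivation_def by blast
  define z where "z = (\<lambda>i::nat. tri 0 0 1)(1 := x, 2 := y, 3 := tri 0 m 0)"
  have "lie_poly n z = 0"
    using assms(1,3) by - (rule lie_poly_zero_prefix[of 2], auto simp: z_def lie_poly_2)
  then have "0 = (\<Sum>i=1..n. lie_poly n (z(i := \<phi> (z i))))"
    using assms(2) \<open>\<phi> 0 = 0\<close> by (metis lie_n_derivation_def)
  also have "\<dots> = (\<Sum>i\<in>{1,2}. lie_poly n (z(i := \<phi> (z i))))"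
  proof (intro sum.mono_neutral_right ballI)
    fix i assume "i \<in> {1..n} - {1,2}"
    then show "lie_poly n (z(i := \<phi> (z i))) = 0"
      using assms(1,3) by - (rule lie_poly_zero_prefix[of 2], auto simp: z_def lie_poly_2)
  qed (use assms(1) in auto)
  also have "\<dots> = lie_poly n (z(1 := \<phi> x)) + lie_poly n (z(2 := \<phi> y))"
    by (simp add: z_def)
  finally have sum0: "lie_poly n (z(1 := \<phi> x)) + lie_poly n (z(2 := \<phi> y)) = 0"
    by simp
  show ?thesis
  proof (cases "n = 2")
    case True
    with sum0 have "w = 0"
      by (simp add: lie_poly_2 z_def w)
    then show ?thesis
      by (simp add: tri_0)
  next
    case False
    have corner_part: "lie_poly n z' = tri 0 (diag1 c * m - m * diag2 c) 0"
      if "commutator (z' 1) (z' 2) = c" "\<And>i. 3 \<le> i \<Longrightarrow> z' i = z i" for z' c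
    proof (rule lie_poly_corner_padded[of 3])
      show "lie_poly 3 z' = tri 0 (diag1 c * m - m * diag2 c) 0"
      proof -
        obtain a p b where "c = tri a p b"
          by (rule tri_cases)
        then show ?thesis
          using that(1) that(2)[of 3]
          by (simp add: lie_poly_3 z_def commutator_tri commutator_def)
      qed
    qed (use that assms(1) False in \<open>auto simp: z_def\<close>)
    have "lie_poly n (z(1 := \<phi> x)) =
        tri 0 (diag1 (commutator (\<phi> x) y) * m - m * diag2 (commutator (\<phi> x) y)) 0"
      "lie_poly n (z(2 := \<phi> y)) =
        tri 0 (diag1 (commutator x (\<phi> y)) * m - m * diag2 (commutator x (\<phi> y))) 0"
      by (intro corner_part; simp add: z_def)+
    with sum0 show ?thesis
      by (simp add: w tri_0 algebra_simps)
  qed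
qed

text \<open>The left and right module laws of \<open>g\<close> over \<open>h\<^sub>1\<close> and \<open>h\<^sub>2\<close> force both of these to be
  derivations: compute \<open>g(aa')\<close> in two ways, using that the corner contains \<open>1\<close>.\<close>

lemma derivation_from_corner_laws:
  fixes h :: "'a::ring_1 upper_tri2 \<Rightarrow> 'a upper_tri2"
  assumes hom: "module_hom s s h"
    and h: "\<And>a m b. h (tri a m b) = tri (h\<^sub>1 a) (g m) (h\<^sub>2 b)"
    and left: "\<And>a m. g (a * m) = h\<^sub>1 a * m + a * g m"
    and right: "\<And>m b. g (m * b) = g m * b + m * h\<^sub>2 b"
  shows "derivation s h"
proof -
  have g_add: "g (m + m') = g m + g m'" for m m'
    using module_hom.add[OF hom, of "tri 0 m 0" "tri 0 m' 0"] by (simp add: h)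
  have h1: "h\<^sub>1 (a * b) = h\<^sub>1 a * b + a * h\<^sub>1 b" for a b
    using left[of "a * b" 1] left[of a b] left[of b 1] by (simp add: algebra_simps)
  have h2: "h\<^sub>2 (a * b) = h\<^sub>2 a * b + a * h\<^sub>2 b" for a b
    using right[of 1 "a * b"] right[of a b] right[of 1 a] by (simp add: algebra_simps)
  have "h (x * y) = h x * y + x * h y" for x y
  proof -
    obtain a m b a' m' b' where "x = tri a m b" "y = tri a' m' b'"
      by (meson tri_cases)
    then show ?thesis
      by (simp add: h g_add left[of a m'] right[of m b'] h1 h2 algebra_simps)
  qed
  with hom show ?thesis
    by (simp add: derivation_def)
qed

text \<open>The candidate for the central part is read off from the misplaced diagonal entries:
  every derivation sends \<open>(a, 0, 0)\<close> to a matrix with lower diagonal entry \<open>0\<close> and \<open>(0, 0, b)\<close> to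
  one with upper diagonal entry \<open>0\<close>, so \<open>Q(a)\<close> and \<open>P'(b)\<close> must come from the central summand
  \<open>\<tau>\<close>.\<close>

lemma normalised_lie_n_derivation:
  fixes \<phi> :: "'a::ring_1 upper_tri2 \<Rightarrow> 'a upper_tri2"
  assumes "2 \<le> n" and alg: "unital_algebra smult"
    and lie: "lie_n_derivation (smult_upper_tri2 smult) n \<phi>"
    and f: "\<phi> (tri 0 0 1) \<in> centre"
    and A: "commutative_ring TYPE('a) \<or> prime_ring TYPE('a)"
  obtains h where "derivation (smult_upper_tri2 smult) h" "\<And>x. \<phi> x - h x \<in> centre"
proof -
  interpret unital_algebra smult by fact
  have hom: "module_hom (smult_upper_tri2 smult) (smult_upper_tri2 smult) \<phi>"
    using lie by (simp add: lie_n_derivation_def)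
  note \<phi>_add = module_hom.add[OF hom] and \<phi>_scale = module_hom.scale[OF hom]
  note leibniz = corner_leibniz[OF assms(1) lie f]
  define g P Q P' Q' where defs:
    "g m = corner (\<phi> (tri 0 m 0))"
    "P a = diag1 (\<phi> (tri a 0 0))" "Q a = diag2 (\<phi> (tri a 0 0))"
    "P' b = diag1 (\<phi> (tri 0 0 b))" "Q' b = diag2 (\<phi> (tri 0 0 b))" for m a b

  have on_corner: "\<phi> (tri 0 m 0) = tri 0 (corner (\<phi> (tri a m b))) 0" for a m b
  proof -
    have "commutator x (tri 0 0 1) = tri 0 (corner x) 0" for x :: "'a upper_tri2"
      by (cases x rule: tri_cases) (simp add: commutator_tri, simp add: commutator_def)
    then show ?thesis
      using leibniz[of "tri a m b" "tri 0 0 1"] f by (simp add: commutator_centre tri_0)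
  qed
  have \<phi>_corner: "\<phi> (tri 0 m 0) = tri 0 (g m) 0" for m
    using on_corner[of m 0 0] by (simp add: defs)
  have corner_\<phi>: "corner (\<phi> (tri a m b)) = g m" for a m b
    using on_corner[of m a b] \<phi>_corner by simp
  have g0: "g 0 = 0"
    using \<phi>_corner[of 0] module_hom.zero[OF hom] by (simp add: tri_0)
  have \<phi>_diag1: "\<phi> (tri a 0 0) = tri (P a) 0 (Q a)" for a
    using corner_\<phi>[of a 0 0] tri_collapse[of "\<phi> (tri a 0 0)"] by (simp add: defs(2,3) g0)
  have \<phi>_diag2: "\<phi> (tri 0 0 b) = tri (P' b) 0 (Q' b)" for b
    using corner_\<phi>[of 0 0 b] tri_collapse[of "\<phi> (tri 0 0 b)"] by (simp add: defs(4,5) g0)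
  have \<phi>: "\<phi> (tri a m b) = tri (P a + P' b) (g m) (Q a + Q' b)" for a m b
    using \<phi>_add[of "tri a 0 0" "tri 0 m b"] \<phi>_add[of "tri 0 m 0" "tri 0 0 b"]
    by (simp add: \<phi>_corner \<phi>_diag1 \<phi>_diag2)

  have left: "g (a * m) = P a * m - m * Q a + a * g m" for a m
    using leibniz[of "tri a 0 0" "tri 0 m 0" "a * m" "P a * m - m * Q a" "a * g m"]
    by (simp add: \<phi>_corner \<phi>_diag1 commutator_tri commutator_def)
  have right: "g (m * b) = m * Q' b - P' b * m + g m * b" for m b
    using leibniz[of "tri 0 m 0" "tri 0 0 b" "m * b" "g m * b" "m * Q' b - P' b * m"]
    by (simp add: \<phi>_corner \<phi>_diag2 commutator_tri commutator_def)

  have commutators: "commutator a (P' b) * m = m * commutator (Q a) b" for a b m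
    using commuting_diagonals[OF assms(1) lie _ refl, of "tri a 0 0" "tri 0 0 b" m]
    by (simp add: \<phi>_diag1 \<phi>_diag2 commutator_tri tri_0)
  have same: "commutator a (P' b) = commutator (Q a) b" for a b
    using commutators[of a b 1] by simp
  have Q: "Q a \<in> centre" for a
  proof (use A in \<open>elim disjE\<close>)
    assume "prime_ring TYPE('a)"
    moreover have "commutator (Q a) b \<in> centre" for b
      using commutators[of a b] same[of a b] by (simp add: centre_def)
    ultimately show ?thesis
      by (rule prime_central_commutators)
  qed (simp add: commutative_ring_def centre_def)
  then have P': "P' b \<in> centre" for b
    using same[of _ b] commutator_centre(1)[OF Q, of _ b] by (simp add: centre_def commutator_def)

  define \<tau> where "\<tau> x = (let c = Q (diag1 x) + P' (diag2 x) in tri c 0 c)" for x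
  have \<tau>: "\<tau> x \<in> centre" for x
  proof -
    have "Q (diag1 x) + P' (diag2 x) \<in> centre"
      using Q[of "diag1 x"] P'[of "diag2 x"] by (simp add: centre_def distrib_left distrib_right)
    then show ?thesis
      by (simp add: \<tau>_def Let_def scalar_in_centre)
  qed
  have Q_add: "Q (a + b) = Q a + Q b" and P'_add: "P' (a + b) = P' a + P' b" for a b
    using \<phi>_add[of "tri a 0 0" "tri b 0 0"] \<phi>_add[of "tri 0 0 a" "tri 0 0 b"]
    by (simp_all add: \<phi>_diag1 \<phi>_diag2)
  have Q_scale: "Q (smult r a) = smult r (Q a)" and P'_scale: "P' (smult r a) = smult r (P' a)" for r a
    using \<phi>_scale[of r "tri a 0 0"] \<phi>_scale[of r "tri 0 0 a"]
    by (simp_all add: \<phi>_diag1 \<phi>_diag2 smult_tri)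
  have \<tau>_hom: "module_hom (smult_upper_tri2 smult) (smult_upper_tri2 smult) \<tau>"
    using hom by (simp add: module_hom_iff \<tau>_def Let_def Q_add P'_add Q_scale P'_scale smult_tri
        scale_right_distrib ac_simps)

  show ?thesis
  proof (rule that[of "\<lambda>x. \<phi> x - \<tau> x"])
    show "derivation (smult_upper_tri2 smult) (\<lambda>x. \<phi> x - \<tau> x)"
    proof (rule derivation_from_corner_laws)
      show "\<phi> (tri a m b) - \<tau> (tri a m b) = tri (P a - Q a) (g m) (Q' b - P' b)" for a m b
        by (simp add: \<phi> \<tau>_def Let_def)
      show "g (a * m) = (P a - Q a) * m + a * g m" for a m
        using Q[of a] by (simp add: left centre_def algebra_simps)
      show "g (m * b) = g m * b + m * (Q' b - P' b)" for m b
        using P'[of b] by (simp add: right centre_def algebra_simps)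
    qed (rule module_hom_diff'[OF hom \<tau>_hom])
  qed (use \<tau> in simp)
qed

text \<open>If \<open>\<phi> f = (c, m\<^sub>0, c)\<close> then \<open>[f, (0, m\<^sub>0, 0)] = (0, - m\<^sub>0, 0)\<close>, so adding the inner derivation
  \<open>[_, (0, m\<^sub>0, 0)]\<close> makes the image of \<open>f\<close> the central scalar \<open>c\<close>.\<close>

theorem corollary3p8:
  fixes smult :: "'r::comm_ring_1 \<Rightarrow> 'a::ring_1 \<Rightarrow> 'a"
    and n :: nat
    and \<phi> :: "'a upper_tri2 \<Rightarrow> 'a upper_tri2"
  assumes "n \<ge> 2"
    and "unital_algebra smult"
    and "torsion_free 2 TYPE('a upper_tri2)"
    and "torsion_free (n - 1) TYPE('a upper_tri2)"
    and "commutative_ring TYPE('a) \<or> (\<not> commutative_ring TYPE('a) \<and> prime_ring TYPE('a))"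
    and "lie_n_derivation (smult_upper_tri2 smult) n \<phi>"
  shows "standard_lie_n_derivation (smult_upper_tri2 smult) n \<phi>"
proof -
  obtain c m\<^sub>0 where c: "c \<in> centre" and f: "\<phi> (tri 0 0 1) = tri c m\<^sub>0 c"
    using lie_n_derivation_at_idempotent[OF assms(1,6,4)] .
  define d where "d x = commutator x (tri 0 m\<^sub>0 0)" for x :: "'a upper_tri2"
  have d: "derivation (smult_upper_tri2 smult) d"
    unfolding d_def
    by (intro derivation_inner unital_algebra.unital_algebra_upper_tri2 assms(2))
  have "lie_n_derivation (smult_upper_tri2 smult) n (\<lambda>x. \<phi> x + d x)"
    using assms(1,6) d by (intro lie_n_derivation_add_derivation) auto
  moreover have "\<phi> (tri 0 0 1) + d (tri 0 0 1) \<in> centre"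
    using scalar_in_centre[OF c] by (simp add: f d_def commutator_def)
  moreover have "commutative_ring TYPE('a) \<or> prime_ring TYPE('a)"
    using assms(5) by blast
  ultimately obtain h where h: "derivation (smult_upper_tri2 smult) h"
    and central: "\<And>x. \<phi> x + d x - h x \<in> centre"
    using normalised_lie_n_derivation[OF assms(1,2)] by blast
  show ?thesis
  proof (rule standard_if_central_difference[OF assms(1,6)])
    show "derivation (smult_upper_tri2 smult) (\<lambda>x. h x - d x)"
      using h d by (rule derivation_diff)
    show "\<phi> x - (h x - d x) \<in> centre" for x
      using central[of x] by (simp add: algebra_simps)
  qed
qed

end
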